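(* Let $G=(V(G),E(G))$ be a graph. Then $$\gamma_{coe}\big(G^{\frac{1}{2}}\big)\leq |V(G)|.$$
   Context: All graphs are finite and simple. A set $D\subseteq V$ is a dominating set of a graph $H=(V,E)$ if every vertex of $V-D$ is adjacent to at least one vertex of $D$. A dominating set $D$ is a co-even dominating set of $H$ if the degree (in $H$) of every vertex of $V-D$ is even. The co-even domination number $\gamma_{coe}(H)$ is the minimum cardinality of a co-even dominating set of $H$. For a positive integer $k$, the $k$-subdivision $G^{\frac{1}{k}}$ of a graph $G$ is the graph obtained by replacing each edge $uv$ of $G$ with a path of length $k$ (i.e. with $k$ edges) joining $u$ and $v$, whose $k-1$ internal vertices are new and distinct for distinct edges; thus $G^{\frac{1}{k}}$ has $|V(G)|+(k-1)|E(G)|$ vertices and $k|E(G)|$ edges. *)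

theory Defs
  imports "Graph_Theory.Pair_Digraph"
begin

text \<open>
  A finite simple graph is a \<^locale>\<open>pair_graph\<close>: a finite loop-free digraph without
  parallel arcs whose arc relation is symmetric. An undirected edge is the pair of arcs
  \<open>(u, v)\<close> and \<open>(v, u)\<close>, so \<open>card (parcs G)\<close> is twice the number of edges,
  and the degree of a vertex is its out-degree.
\<close>

definition dominating_set :: "'a pair_pre_digraph \<Rightarrow> 'a set \<Rightarrow> bool" where
  "dominating_set H D \<longleftrightarrow>
     D \<subseteq> pverts H \<and> (\<forall>v \<in> pverts H - D. \<exists>d \<in> D. (v, d) \<in> parcs H)"

definition coeven_dominating_set :: "'a pair_pre_digraph \<Rightarrow> 'a set \<Rightarrow> bool" where
  "coeven_dominating_set H D \<longleftrightarrow>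
     dominating_set H D \<and> (\<forall>v \<in> pverts H - D. even (out_degree (with_proj H) v))"

definition coeven_domination_number :: "'a pair_pre_digraph \<Rightarrow> nat" where
  "coeven_domination_number H = Min (card ` {D. coeven_dominating_set H D})"

text \<open>
  The set of candidates in the previous definition is finite and nonempty for every finite
  graph, so the minimum is a genuine one.
\<close>

lemma finite_coeven_dominating_sets:
  assumes "finite (pverts H)"
  shows "finite {D. coeven_dominating_set H D}"
  by (rule finite_subset[of _ "Pow (pverts H)"])
    (auto simp: assms coeven_dominating_set_def dominating_set_def)

lemma coeven_dominating_set_pverts: "coeven_dominating_set H (pverts H)"
  by (simp add: coeven_dominating_set_def dominating_set_def)

text \<open>
  The path of length \<open>k\<close> replacing the edge \<open>uv\<close> consists of the points at
  distance \<open>0, \<dots>, k\<close> from \<open>u\<close>. The point at distance \<open>i\<close> from \<open>u\<close> lies at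
  distance \<open>k - i\<close> from \<open>v\<close>; an internal point is represented by the set
  \<open>{(u, i), (v, k - i)}\<close>, which does not depend on the direction in which the edge is
  traversed.
\<close>

datatype 'a subdiv_vertex = Orig 'a | Inner "('a \<times> nat) set"

definition subdiv_point :: "nat \<Rightarrow> 'a \<Rightarrow> 'a \<Rightarrow> nat \<Rightarrow> 'a subdiv_vertex" where
  "subdiv_point k u v i =
     (if i = 0 then Orig u else if i = k then Orig v else Inner {(u, i), (v, k - i)})"

definition k_subdivision :: "nat \<Rightarrow> 'a pair_pre_digraph \<Rightarrow> 'a subdiv_vertex pair_pre_digraph" where
  "k_subdivision k G =
     \<lparr> pverts = Orig ` pverts G \<union>
                {subdiv_point k u v i | u v i. (u, v) \<in> parcs G \<and> 0 < i \<and> i < k},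
       parcs = {(subdiv_point k u v i, subdiv_point k u v (Suc i)) | u v i.
                (u, v) \<in> parcs G \<and> i < k} \<rparr>"

lemma subdiv_point_swap: "0 < k \<Longrightarrow> i \<le> k \<Longrightarrow> subdiv_point k v u (k - i) = subdiv_point k u v i"
  by (auto simp: subdiv_point_def)

lemma subdiv_point_eq_iff:
  assumes "0 < i" "i < k" "0 < j" "j < k"
  shows "subdiv_point k u v i = subdiv_point k x y j \<longleftrightarrow>
    (u = x \<and> v = y \<and> i = j) \<or> (u = y \<and> v = x \<and> i = k - j)"
  using assms by (auto simp: subdiv_point_def doubleton_eq_iff)

theorem pair_graph_k_subdivision:
  fixes G :: "'a pair_pre_digraph"
  assumes "pair_graph G"
  shows "pair_graph (k_subdivision k G)"
proof -
  interpret pair_graph G by fact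
  have sym: "(v, u) \<in> parcs G" if "(u, v) \<in> parcs G" for u v
    using that sym_arcs by (auto simp: symmetric_def dest: symD)
  let ?P = "(\<lambda>((u, v), i). subdiv_point k u v i) ` (parcs G \<times> {..k})"
  have finP: "finite ?P"
    by simp
  have verts: "subdiv_point k u v i \<in> pverts (k_subdivision k G)"
    if "(u, v) \<in> parcs G" "i \<le> k" for u v i
  proof -
    consider "i = 0" | "i = k" | "0 < i" "i < k" using \<open>i \<le> k\<close> by linarith
    then show ?thesis
      using that wellformed'[OF that(1)]
      by cases (auto simp: k_subdivision_def, auto simp: subdiv_point_def)
  qed
  have symK: "(b, a) \<in> parcs (k_subdivision k G)" if "(a, b) \<in> parcs (k_subdivision k G)" for a b
  proof -
    from that obtain u v i where *: "(u, v) \<in> parcs G" "i < k"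
      "a = subdiv_point k u v i" "b = subdiv_point k u v (Suc i)"
      by (auto simp: k_subdivision_def)
    have "b = subdiv_point k v u (k - Suc i)" "a = subdiv_point k v u (Suc (k - Suc i))"
      using subdiv_point_swap[of k "Suc i" v u] subdiv_point_swap[of k i v u] *(2-4)
      by (simp_all add: Suc_diff_Suc)
    moreover have "k - Suc i < k"
      using *(2) by simp
    ultimately show ?thesis
      using sym[OF *(1)] unfolding k_subdivision_def pair_pre_digraph.simps by blast
  qed
  show ?thesis
  proof
    show "finite (pverts (k_subdivision k G))"
      by (rule finite_subset[of _ "Orig ` pverts G \<union> ?P"]) (use finP in \<open>force simp: k_subdivision_def\<close>)+
    show "finite (parcs (k_subdivision k G))"
      by (rule finite_subset[of _ "?P \<times> ?P"]) (use finP in \<open>force simp: k_subdivision_def\<close>)+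
    show "symmetric (with_proj (k_subdivision k G))"
      using symK by (auto simp: symmetric_def intro: symI)
  next
    fix e assume "e \<in> parcs (k_subdivision k G)"
    then obtain u v i where *: "(u, v) \<in> parcs G" "i < k"
      "e = (subdiv_point k u v i, subdiv_point k u v (Suc i))"
      by (auto simp: k_subdivision_def)
    then show "fst e \<in> pverts (k_subdivision k G)" "snd e \<in> pverts (k_subdivision k G)"
      using verts by auto
    show "fst e \<noteq> snd e"
      using * no_loops'[OF *(1)] by (auto simp: subdiv_point_def doubleton_eq_iff)
  qed
qed

text \<open>
  Vertex and edge counts, both doubled since arcs are counted:
  \<open>|V| + (k - 1) |E|\<close> vertices and \<open>k |E|\<close> edges.
\<close>

theorem card_pverts_k_subdivision:
  fixes G :: "'a pair_pre_digraph"
  assumes "pair_graph G"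
  shows "2 * card (pverts (k_subdivision k G)) = 2 * card (pverts G) + (k - 1) * card (parcs G)"
proof -
  interpret pair_graph G by fact
  have sym: "(v, u) \<in> parcs G" if "(u, v) \<in> parcs G" for u v
    using that sym_arcs by (auto simp: symmetric_def dest: symD)
  define S where "S = parcs G \<times> {0<..<k}"
  define f where "f = (\<lambda>((u :: 'a, v), i). subdiv_point k u v i)"
  have finS: "finite S"
    by (simp add: S_def)
  have eq: "pverts (k_subdivision k G) = Orig ` pverts G \<union> f ` S"
    by (force simp: k_subdivision_def S_def f_def)
  have disj: "Orig ` pverts G \<inter> f ` S = {}"
    by (auto simp: S_def f_def subdiv_point_def split: if_splits)
  have fibre: "card {s \<in> S. f s = y} = 2" if "y \<in> f ` S" for y
  proof -
    from that obtain u v i where *: "(u, v) \<in> parcs G" "0 < i" "i < k" "y = subdiv_point k u v i"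
      by (auto simp: S_def f_def)
    have "{s \<in> S. f s = y} = {((u, v), i), ((v, u), k - i)}"
      using * sym[OF *(1)] by (auto simp: S_def f_def subdiv_point_eq_iff)
    then show ?thesis
      using no_loops'[OF *(1)] by auto
  qed
  have "card S = (\<Sum>y\<in>f ` S. card {s \<in> S. f s = y})"
    using sum.group[OF finS finite_imageI[OF finS] order_refl, of "\<lambda>_. 1 :: nat" f]
    by (simp only: card_eq_sum)
  also have "\<dots> = 2 * card (f ` S)"
    using fibre by simp
  finally have "2 * card (f ` S) = (k - 1) * card (parcs G)"
    by (simp add: S_def card_cartesian_product mult.commute)
  moreover have "card (Orig ` pverts G \<union> f ` S) = card (pverts G) + card (f ` S)"
    using disj finS by (subst card_Un_disjoint) (auto simp: card_image inj_on_def)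
  ultimately show ?thesis
    by (simp add: eq)
qed

theorem card_parcs_k_subdivision:
  fixes G :: "'a pair_pre_digraph"
  assumes "pair_graph G"
  shows "card (parcs (k_subdivision k G)) = k * card (parcs G)"
proof -
  interpret pair_graph G by fact
  define g where "g = (\<lambda>((u :: 'a, v), i). (subdiv_point k u v i, subdiv_point k u v (Suc i)))"
  have eq: "parcs (k_subdivision k G) = g ` (parcs G \<times> {..<k})"
    by (force simp: k_subdivision_def g_def)
  have "inj_on g (parcs G \<times> {..<k})"
    by (auto simp: inj_on_def g_def subdiv_point_def doubleton_eq_iff split: if_splits
        dest!: no_loops')
  then show ?thesis
    by (simp add: eq card_image card_cartesian_product)
qed

end

theory Submission
  imports Defs
begin

text \<open>The original vertices form a co-even dominating set of the 2-subdivision. Any other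
  vertex is the midpoint of an edge uv, and its neighbours are exactly u and v
  (\<open>out_arcs_midpoint\<close>). It is therefore dominated, and since u and v are distinct its
  degree is 2, which is even (\<open>coeven_dominating_set_2_subdivision\<close>). The minimum is at
  most the size of this set, which is |V(G)| because \<open>Orig\<close> is injective.\<close>

lemma coeven_domination_number_le:
  assumes "finite (pverts H)" "coeven_dominating_set H D"
  shows "coeven_domination_number H \<le> card D"
  unfolding coeven_domination_number_def
  using assms finite_coeven_dominating_sets by (intro Min_le) auto

text \<open>The midpoint \<open>Inner {(u, 1), (v, 1)}\<close> determines the edge but not its
  direction. Traversing the edge from u to v yields the arc to \<open>Orig v\<close>, the reverse
  traversal the arc to \<open>Orig u\<close>, and no other edge passes through
  \<open>w\<close>.\<close>

lemma out_arcs_midpoint: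
  assumes "pair_graph G" and uv: "(u, v) \<in> parcs G"
  defines "w \<equiv> subdiv_point 2 u v 1"
  shows "out_arcs (with_proj (k_subdivision 2 G)) w = {(w, Orig u), (w, Orig v)}"
proof -
  interpret pair_graph G by fact
  have vu: "(v, u) \<in> parcs G"
    using uv sym_arcs by (auto simp: symmetric_def dest: symD)
  have w: "w = subdiv_point 2 v u 1"
    using subdiv_point_swap[of 2 1 v u] by (simp add: w_def)
  have "(w, z) \<in> parcs (k_subdivision 2 G) \<longleftrightarrow> z = Orig u \<or> z = Orig v" for z
  proof
    assume "(w, z) \<in> parcs (k_subdivision 2 G)"
    then obtain x y i where xyi: "i < 2" "w = subdiv_point 2 x y i" "z = subdiv_point 2 x y (Suc i)"
      by (auto simp: k_subdivision_def)
    \<comment> \<open>For \<open>i = 0\<close> the tail of the arc would be an \<open>Orig\<close>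
      vertex, while \<open>w\<close> is an \<open>Inner\<close> one.\<close>
    then have "i = 1"
      by (cases i) (auto simp: w_def subdiv_point_def)
    \<comment> \<open>Now \<open>z = Orig y\<close>, and equality of the two doubletons representing
      \<open>w\<close> forces y to be u or v.\<close>
    then show "z = Orig u \<or> z = Orig v"
      using xyi by (auto simp: w_def subdiv_point_def doubleton_eq_iff)
  next
    have arc: "(subdiv_point 2 x y 1, Orig y) \<in> parcs (k_subdivision 2 G)"
      if "(x, y) \<in> parcs G" for x y
      using that unfolding k_subdivision_def pair_pre_digraph.simps mem_Collect_eq
      by (intro exI[of _ x] exI[of _ y] exI[of _ 1]) (simp add: subdiv_point_def)
    assume "z = Orig u \<or> z = Orig v"
    then show "(w, z) \<in> parcs (k_subdivision 2 G)"
      using arc[OF uv] arc[OF vu] w w_def by auto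
  qed
  then have "e \<in> out_arcs (with_proj (k_subdivision 2 G)) w \<longleftrightarrow> e \<in> {(w, Orig u), (w, Orig v)}" for e
    by (cases e) (simp, blast)
  then show ?thesis
    by (rule set_eqI)
qed

lemma coeven_dominating_set_2_subdivision:
  assumes "pair_graph G"
  shows "coeven_dominating_set (k_subdivision 2 G) (Orig ` pverts G)"
proof -
  interpret pair_graph G by fact
  let ?H = "k_subdivision 2 G"
  have "(\<exists>d \<in> Orig ` pverts G. (w, d) \<in> parcs ?H) \<and> even (out_degree (with_proj ?H) w)"
    if w: "w \<in> pverts ?H - Orig ` pverts G" for w
  proof -
    obtain u v where uv: "(u, v) \<in> parcs G" and w_eq: "w = subdiv_point 2 u v 1"
      using w by (auto simp: k_subdivision_def less_2_cases_iff)
    have out: "out_arcs (with_proj ?H) w = {(w, Orig u), (w, Orig v)}"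
      using out_arcs_midpoint[OF assms uv] w_eq by simp
    then have "(w, Orig u) \<in> parcs ?H"
      by (auto simp: out_arcs_def)
    \<comment> \<open>Looplessness of G gives \<open>u \<noteq> v\<close>, so the two out-arcs are
      distinct.\<close>
    moreover have "out_degree (with_proj ?H) w = 2"
      using no_loops'[OF uv] by (simp add: out_degree_def out)
    ultimately show ?thesis
      using wellformed'[OF uv] by auto
  qed
  moreover have "Orig ` pverts G \<subseteq> pverts ?H"
    by (simp add: k_subdivision_def)
  ultimately show ?thesis
    by (simp add: coeven_dominating_set_def dominating_set_def)
qed

theorem theorem3p2:
  fixes G :: "'a pair_pre_digraph"
  assumes "pair_graph G"
  shows "coeven_domination_number (k_subdivision 2 G) \<le> card (pverts G)"
proof -
  interpret H: pair_graph "k_subdivision 2 G"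
    using assms by (rule pair_graph_k_subdivision)
  have "coeven_domination_number (k_subdivision 2 G) \<le> card (Orig ` pverts G)"
    using H.finite_verts coeven_dominating_set_2_subdivision[OF assms]
    by (intro coeven_domination_number_le) simp_all
  also have "\<dots> = card (pverts G)"
    by (simp add: card_image inj_on_def)
  finally show ?thesis .
qed

end
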